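(* The topological group $\mathcal{H}(\omega^* )$ is not a $P$-group.
   Context: $\beta\omega$ is the Čech–Stone compactification of the discrete space $\omega$, and $\omega^*=\beta\omega\setminus\omega$. For a compact Hausdorff space $X$, $\mathcal{H}(X)$ is the group of all homeomorphisms $X\to X$ under composition, endowed with the compact-open topology, i.e. the topology with subbase all sets $[K,U]=\{f\in\mathcal{H}(X): f(K)\subseteq U\}$, $K\subseteq X$ compact, $U\subseteq X$ open; it is a topological group. A $P$-group is a topological group whose underlying space is a $P$-space, that is, a space in which every $G_\delta$-subset is open. The result is in $\mathsf{ZFC}$. *)

theory Defs
  imports "HOL-Analysis.Analysis" "HOL-Algebra.Bij"
begin

section \<open>The Cech--Stone compactification\<close>

definition unit_functions :: "'a topology \<Rightarrow> ('a \<Rightarrow> real) set" where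
  "unit_functions X =
     {f \<in> extensional (topspace X). continuous_map X (top_of_set {0..1}) f}"

definition unit_cube :: "'a topology \<Rightarrow> (('a \<Rightarrow> real) \<Rightarrow> real) topology" where
  "unit_cube X = product_topology (\<lambda>f. top_of_set {0..1}) (unit_functions X)"

definition cech_stone_map :: "'a topology \<Rightarrow> 'a \<Rightarrow> ('a \<Rightarrow> real) \<Rightarrow> real" where
  "cech_stone_map X x = (\<lambda>f \<in> unit_functions X. f x)"

text \<open>Cech's construction: the closure of the image of \<open>X\<close> under evaluation in the cube
  \<open>[0,1]\<close> to the power \<open>C(X,[0,1])\<close>. For a Tychonoff space \<open>X\<close> this is a compact Hausdorff space
  containing \<open>X\<close> densely, to which continuous maps into compact Hausdorff spaces extend
  (see the lemmas below).\<close>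

definition cech_stone :: "'a topology \<Rightarrow> (('a \<Rightarrow> real) \<Rightarrow> real) topology" where
  "cech_stone X =
     subtopology (unit_cube X) (unit_cube X closure_of (cech_stone_map X ` topspace X))"

lemma topspace_cech_stone:
  "topspace (cech_stone X) = unit_cube X closure_of (cech_stone_map X ` topspace X)"
  by (simp add: cech_stone_def closure_of_subset_topspace inf.absorb2)

lemma compact_space_cech_stone: "compact_space (cech_stone X)"
proof -
  have "compact_space (unit_cube X)"
    by (simp add: unit_cube_def compact_space_product_topology compact_space_subtopology)
  then show ?thesis
    by (simp add: cech_stone_def closedin_compact_space compact_space_subtopology)
qed

lemma Hausdorff_space_cech_stone: "Hausdorff_space (cech_stone X)"
  by (simp add: cech_stone_def unit_cube_def Hausdorff_space_subtopology
      Hausdorff_space_product_topology)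

lemma cech_stone_map_in: "cech_stone_map X ` topspace X \<subseteq> topspace (unit_cube X)"
  by (auto simp: cech_stone_map_def unit_cube_def unit_functions_def continuous_map_def PiE_def Pi_def)

lemma dense_cech_stone:
  "cech_stone X closure_of (cech_stone_map X ` topspace X) = topspace (cech_stone X)"
  by (metis cech_stone_def closure_of_subset closure_of_subtopology_subset 
      closure_of_subtopology inf.absorb2 inf.idem topspace_cech_stone cech_stone_map_in)

lemma embedding_unit_cube:
  assumes "completely_regular_space X" "Hausdorff_space X"
  shows "embedding_map X (unit_cube X) (cech_stone_map X)"
proof -
  have "mspace (submetric (cfunspace X euclidean_metric) {f. f \<in> topspace X \<rightarrow> {0..1::real}})
      = unit_functions X"
    by (auto simp: unit_functions_def continuous_map_in_subtopology image_subset_iff_funcset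
        intro: bounded_subset[OF bounded_closed_interval[of "0::real" 1]])
  then show ?thesis
    using completely_regular_space_cube_embedding_explicit[OF assms]
    by (simp add: unit_cube_def cech_stone_map_def[abs_def])
qed

lemma embedding_cech_stone:
  assumes "completely_regular_space X" "Hausdorff_space X"
  shows "embedding_map X (cech_stone X) (cech_stone_map X)"
  using embedding_unit_cube[OF assms] closure_of_subset[OF cech_stone_map_in[of X]]
  by (simp add: cech_stone_def embedding_map_def subtopology_subtopology inf.absorb2)

lemma cech_stone_extension:
  assumes f: "continuous_map X Y f" and Y: "compact_space Y" "Hausdorff_space Y"
  obtains g where "continuous_map (cech_stone X) Y g"
    "\<And>x. x \<in> topspace X \<Longrightarrow> g (cech_stone_map X x) = f x"
proof -
  define F where "F p = (\<lambda>h \<in> unit_functions Y. p (restrict (h \<circ> f) (topspace X)))"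
    for p :: "('a \<Rightarrow> real) \<Rightarrow> real"
  let ?E = "cech_stone_map Y ` topspace Y"
  have hf: "restrict (h \<circ> f) (topspace X) \<in> unit_functions X" if "h \<in> unit_functions Y" for h
  proof -
    have "continuous_map X (top_of_set {0..1}) (h \<circ> f)"
      using that f by (auto simp: unit_functions_def intro: continuous_map_compose)
    then have "continuous_map X (top_of_set {0..1}) (restrict (h \<circ> f) (topspace X))"
      by (rule continuous_map_eq) auto
    then show ?thesis by (simp add: unit_functions_def)
  qed
  have F: "continuous_map (unit_cube X) (unit_cube Y) F"
    unfolding unit_cube_def continuous_map_componentwise
  proof (intro conjI ballI)
    fix h assume "h \<in> unit_functions Y"
    then have "continuous_map (product_topology (\<lambda>f. top_of_set {0..1}) (unit_functions X))
        (top_of_set {0..1}) (\<lambda>p. p (restrict (h \<circ> f) (topspace X)))"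
      using continuous_map_product_projection[OF hf[of h], of "\<lambda>f. top_of_set {0..1}"] by simp
    then show "continuous_map (product_topology (\<lambda>f. top_of_set {0..1}) (unit_functions X))
        (top_of_set {0..1}) (\<lambda>p. F p h)"
      using \<open>h \<in> unit_functions Y\<close> by (simp add: F_def)
  qed (auto simp: F_def)
  have Fe: "F (cech_stone_map X x) = cech_stone_map Y (f x)" if "x \<in> topspace X" for x
    using that hf by (auto simp: F_def cech_stone_map_def fun_eq_iff)
  have cr: "completely_regular_space Y"
    using Y by (metis compact_Hausdorff_or_regular_imp_normal_space
        normal_imp_completely_regular_space)
  have emb: "embedding_map Y (unit_cube Y) (cech_stone_map Y)"
    by (rule embedding_unit_cube[OF cr Y(2)])
  have "compactin (unit_cube Y) ?E"
    using Y(1) emb continuous_map_in_subtopology homeomorphic_imp_continuous_map image_compactin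
    unfolding compact_space_def embedding_map_def by metis
  moreover have "Hausdorff_space (unit_cube Y)"
    by (simp add: unit_cube_def Hausdorff_space_subtopology Hausdorff_space_product_topology)
  ultimately have clo: "closedin (unit_cube Y) ?E"
    by (simp add: compactin_imp_closedin)
  have fY: "f x \<in> topspace Y" if "x \<in> topspace X" for x
    using that f by (auto simp: continuous_map_def)
  have "F ` topspace (cech_stone X) \<subseteq> unit_cube Y closure_of (F ` (cech_stone_map X ` topspace X))"
    unfolding topspace_cech_stone by (rule continuous_map_image_closure_subset[OF F])
  also have "\<dots> \<subseteq> ?E"
    by (rule closure_of_minimal[OF _ clo]) (auto simp: Fe fY)
  finally have "continuous_map (cech_stone X) (subtopology (unit_cube Y) ?E) F"
    using F unfolding cech_stone_def
    by (auto simp: continuous_map_in_subtopology intro: continuous_map_from_subtopology)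
  moreover obtain k where k: "homeomorphic_maps Y (subtopology (unit_cube Y) ?E) (cech_stone_map Y) k"
    using emb by (auto simp: embedding_map_def homeomorphic_map_maps)
  ultimately have "continuous_map (cech_stone X) Y (k \<circ> F)"
    by (auto simp: homeomorphic_maps_def intro: continuous_map_compose)
  moreover have "(k \<circ> F) (cech_stone_map X x) = f x" if "x \<in> topspace X" for x
    using k fY[OF that] by (simp add: Fe that homeomorphic_maps_def)
  ultimately show thesis using that by blast
qed

section \<open>Homeomorphism groups and P-groups\<close>

text \<open>As in \<^const>\<open>BijGroup\<close>, a map on \<open>X\<close> is taken to be extensional, so that homeomorphisms
  that agree on \<open>topspace X\<close> are equal.\<close>

definition homeos :: "'a topology \<Rightarrow> ('a \<Rightarrow> 'a) set" where
  "homeos X = {f \<in> extensional (topspace X). homeomorphic_map X X f}"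

definition homeo_group :: "'a topology \<Rightarrow> ('a \<Rightarrow> 'a) monoid" where
  "homeo_group X = BijGroup (topspace X) \<lparr>carrier := homeos X\<rparr>"

definition homeo_topology :: "'a topology \<Rightarrow> ('a \<Rightarrow> 'a) topology" where
  "homeo_topology X =
     topology_generated_by {{f \<in> homeos X. f ` K \<subseteq> U} |K U. compactin X K \<and> openin X U}"

definition topological_group :: "('g, 'm) monoid_scheme \<Rightarrow> 'g topology \<Rightarrow> bool" where
  "topological_group G T \<longleftrightarrow>
     group G \<and> topspace T = carrier G \<and>
     continuous_map (prod_topology T T) T (\<lambda>(x, y). x \<otimes>\<^bsub>G\<^esub> y) \<and>
     continuous_map T T (\<lambda>x. inv\<^bsub>G\<^esub> x)"

definition P_space :: "'a topology \<Rightarrow> bool" where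
  "P_space T \<longleftrightarrow> (\<forall>S. gdelta_in T S \<longrightarrow> openin T S)"

definition P_group :: "('g, 'm) monoid_scheme \<Rightarrow> 'g topology \<Rightarrow> bool" where
  "P_group G T \<longleftrightarrow> topological_group G T \<and> P_space T"

lemma homeos_subset_Bij: "homeos X \<subseteq> Bij (topspace X)"
  unfolding homeos_def Bij_def bij_betw_def
  by (auto simp: homeomorphic_eq_everything_map)

lemma subgroup_homeos: "subgroup (homeos X) (BijGroup (topspace X))"
proof (rule group.subgroupI [OF group_BijGroup])
  show "homeos X \<subseteq> carrier (BijGroup (topspace X))"
    using homeos_subset_Bij by (auto simp: BijGroup_def)
  have "restrict id (topspace X) \<in> homeos X"
  proof -
    have "homeomorphic_map X X id" by simp
    then have "homeomorphic_map X X (restrict id (topspace X))"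
      by (rule homeomorphic_map_eq) simp
    then show ?thesis by (simp add: homeos_def)
  qed
  then show "homeos X \<noteq> {}" by blast
next
  fix f assume f: "f \<in> homeos X"
  then have fB: "f \<in> Bij (topspace X)" using homeos_subset_Bij by blast
  obtain g where g: "homeomorphic_maps X X f g"
    using f by (auto simp: homeos_def homeomorphic_map_maps)
  have "inv_into (topspace X) f x = g x" if "x \<in> topspace X" for x
  proof (rule inv_into_f_eq)
    show "inj_on f (topspace X)" using fB by (auto simp: Bij_def bij_betw_def)
    show "g x \<in> topspace X" "f (g x) = x"
      using g that by (auto simp: homeomorphic_maps_def continuous_map_def)
  qed
  then have "homeomorphic_map X X (restrict (inv_into (topspace X) f) (topspace X))"
  proof -
    assume eq: "\<And>x. x \<in> topspace X \<Longrightarrow> inv_into (topspace X) f x = g x"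
    have "homeomorphic_map X X g" using g homeomorphic_maps_map by blast
    then show ?thesis by (rule homeomorphic_map_eq) (simp add: eq)
  qed
  then show "inv\<^bsub>BijGroup (topspace X)\<^esub> f \<in> homeos X"
    by (simp add: inv_BijGroup fB homeos_def)
next
  fix f g assume f: "f \<in> homeos X" and g: "g \<in> homeos X"
  then have "f \<in> Bij (topspace X)" "g \<in> Bij (topspace X)" using homeos_subset_Bij by blast+
  moreover have "homeomorphic_map X X (compose (topspace X) f g)"
  proof (rule homeomorphic_map_eq)
    show "homeomorphic_map X X (f \<circ> g)"
      using f g by (intro homeomorphic_map_compose[of X X g X f]) (auto simp: homeos_def)
  qed (simp add: compose_def)
  ultimately show "f \<otimes>\<^bsub>BijGroup (topspace X)\<^esub> g \<in> homeos X"
    by (simp add: BijGroup_def homeos_def)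
qed

lemma topspace_homeo_topology: "topspace (homeo_topology X) = homeos X"
proof -
  have "homeos X = {f \<in> homeos X. f ` {} \<subseteq> {}}" by auto
  then show ?thesis
    unfolding homeo_topology_def topology_generated_by_topspace
    by auto
qed

lemma openin_homeo_topology:
  assumes "compactin X K" "openin X U"
  shows "openin (homeo_topology X) {f \<in> homeos X. f ` K \<subseteq> U}"
  unfolding homeo_topology_def using assms by (intro topology_generated_by_Basis) blast

lemma homeo_group_mult:
  assumes "f \<in> homeos X" "g \<in> homeos X"
  shows "f \<otimes>\<^bsub>homeo_group X\<^esub> g = compose (topspace X) f g"
  using assms homeos_subset_Bij[of X] by (auto simp: homeo_group_def BijGroup_def)

lemma homeo_group_inv:
  assumes "f \<in> homeos X"
  shows "inv\<^bsub>homeo_group X\<^esub> f = restrict (inv_into (topspace X) f) (topspace X)"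
  using group.m_inv_consistent[OF group_BijGroup subgroup_homeos assms]
    inv_BijGroup[OF subsetD[OF homeos_subset_Bij assms]]
  by (simp add: homeo_group_def)

lemma topological_group_homeo_group:
  assumes X: "compact_space X" "Hausdorff_space X"
  shows "topological_group (homeo_group X) (homeo_topology X)"
proof -
  have G: "group (homeo_group X)"
    unfolding homeo_group_def
    by (rule subgroup.subgroup_is_group[OF subgroup_homeos group_BijGroup])
  have car: "carrier (homeo_group X) = homeos X" by (simp add: homeo_group_def)
  let ?T = "homeo_topology X" and ?S = "topspace X"
  let ?B = "{{f \<in> homeos X. f ` K \<subseteq> U} |K U. compactin X K \<and> openin X U}"
  have iff: "continuous_map T ?T m" if m: "\<And>x. x \<in> topspace T \<Longrightarrow> m x \<in> homeos X"
    and op: "\<And>K U. compactin X K \<Longrightarrow> openin X U \<Longrightarrow> openin T {x \<in> topspace T. m x ` K \<subseteq> U}"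
    for T :: "'b topology" and m
    unfolding homeo_topology_def
  proof (rule continuous_on_generated_topo)
    show "m ` topspace T \<subseteq> \<Union> ?B"
      using topspace_homeo_topology[of X] m
      by (auto simp: homeo_topology_def topology_generated_by_topspace)
    fix V assume "V \<in> ?B"
    then obtain K U where V: "V = {f \<in> homeos X. f ` K \<subseteq> U}" and KU: "compactin X K" "openin X U"
      by blast
    have "m -` V \<inter> topspace T = {x \<in> topspace T. m x ` K \<subseteq> U}"
      using m by (auto simp: V)
    then show "openin T (m -` V \<inter> topspace T)" using op[OF KU] by simp
  qed
  have cont: "continuous_map X X f" and bij: "bij_betw f ?S ?S" if "f \<in> homeos X" for f
    using that homeos_subset_Bij[of X]
    by (auto simp: homeos_def Bij_def homeomorphic_imp_continuous_map)
  have "continuous_map (prod_topology ?T ?T) ?T (\<lambda>x. case x of (f, g) \<Rightarrow> f \<otimes>\<^bsub>homeo_group X\<^esub> g)"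
  proof (rule iff)
    fix x assume "x \<in> topspace (prod_topology ?T ?T)"
    then show "(case x of (f, g) \<Rightarrow> f \<otimes>\<^bsub>homeo_group X\<^esub> g) \<in> homeos X"
      using monoid.m_closed[OF group.is_monoid[OF G]] by (auto simp: topspace_homeo_topology car)
  next
    fix K U assume K: "compactin X K" and U: "openin X U"
    show "openin (prod_topology ?T ?T) {x \<in> topspace (prod_topology ?T ?T).
        (case x of (f, g) \<Rightarrow> f \<otimes>\<^bsub>homeo_group X\<^esub> g) ` K \<subseteq> U}" (is "openin _ ?W")
      unfolding openin_prod_topology_alt
    proof (intro allI impI)
      fix f g assume "(f, g) \<in> ?W"
      then have f: "f \<in> homeos X" and g: "g \<in> homeos X"
        and fg: "compose ?S f g ` K \<subseteq> U"
        by (auto simp: topspace_homeo_topology homeo_group_mult)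
      have KS: "K \<subseteq> ?S" using K by (rule compactin_subset_topspace)
      have gK: "compactin X (g ` K)" using K cont[OF g] by (rule image_compactin)
      have "g ` K \<subseteq> {x \<in> ?S. f x \<in> U}"
        using fg KS compactin_subset_topspace[OF gK] by (auto simp: compose_def)
      moreover have "closedin X (g ` K)" using gK X by (simp add: compactin_imp_closedin)
      moreover have "openin X {x \<in> ?S. f x \<in> U}"
        using cont[OF f] U by (auto simp: continuous_map_def)
      moreover have "normal_space X"
        using X compact_Hausdorff_or_regular_imp_normal_space by blast
      ultimately obtain V where V: "openin X V" "g ` K \<subseteq> V"
        "X closure_of V \<subseteq> {x \<in> ?S. f x \<in> U}"
        unfolding normal_space_alt by meson
      let ?A = "{h \<in> homeos X. h ` (X closure_of V) \<subseteq> U}" and ?C = "{h \<in> homeos X. h ` K \<subseteq> V}"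
      have "openin ?T ?A" "openin ?T ?C"
        using X V K U by (auto intro!: openin_homeo_topology simp: closedin_compact_space)
      moreover have "f \<in> ?A" "g \<in> ?C" using f g V by auto
      moreover have "?A \<times> ?C \<subseteq> ?W"
      proof (rule subsetI)
        fix x assume "x \<in> ?A \<times> ?C"
        then obtain h k where x: "x = (h, k)" and h: "h \<in> homeos X" "h ` (X closure_of V) \<subseteq> U"
          and k: "k \<in> homeos X" "k ` K \<subseteq> V" by blast
        have "V \<subseteq> X closure_of V" by (simp add: V closure_of_subset openin_subset)
        then have "compose ?S h k x \<in> U" if "x \<in> K" for x
          using h k KS that by (metis compose_eq image_subset_iff subsetD)
        then have "compose ?S h k ` K \<subseteq> U" by blast
        then show "x \<in> ?W"
          using h k by (simp add: x topspace_homeo_topology homeo_group_mult)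
      qed
      ultimately show "\<exists>U V. openin ?T U \<and> openin ?T V \<and> f \<in> U \<and> g \<in> V \<and> U \<times> V \<subseteq> ?W"
        by blast
    qed
  qed
  then have mult: "continuous_map (prod_topology ?T ?T) ?T (\<lambda>(f, g). f \<otimes>\<^bsub>homeo_group X\<^esub> g)"
    by simp
  have inv: "continuous_map ?T ?T (\<lambda>f. inv\<^bsub>homeo_group X\<^esub> f)"
  proof (rule iff)
    show "inv\<^bsub>homeo_group X\<^esub> f \<in> homeos X" if "f \<in> topspace ?T" for f
      using that group.inv_closed[OF G] by (simp add: topspace_homeo_topology car)
  next
    fix K U assume K: "compactin X K" and U: "openin X U"
    have KS: "K \<subseteq> ?S" using K by (rule compactin_subset_topspace)
    have US: "U \<subseteq> ?S" using U by (rule openin_subset)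
    have "(inv\<^bsub>homeo_group X\<^esub> f) ` K \<subseteq> U \<longleftrightarrow> f ` (?S - U) \<subseteq> ?S - K" if f: "f \<in> homeos X" for f
    proof -
      have inj: "inj_on f ?S" and sur: "f ` ?S = ?S" using bij[OF f] by (auto simp: bij_betw_def)
      have "(inv\<^bsub>homeo_group X\<^esub> f) ` K = inv_into ?S f ` K"
        using KS by (auto simp: homeo_group_inv f)
      also have "\<dots> \<subseteq> U \<longleftrightarrow> (\<forall>x \<in> ?S. f x \<in> K \<longrightarrow> x \<in> U)"
      proof
        show "\<forall>x \<in> ?S. f x \<in> K \<longrightarrow> x \<in> U" if "inv_into ?S f ` K \<subseteq> U"
          using that inv_into_f_f[OF inj] by (metis image_subset_iff)
        show "inv_into ?S f ` K \<subseteq> U" if *: "\<forall>x \<in> ?S. f x \<in> K \<longrightarrow> x \<in> U"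
        proof (rule image_subsetI)
          fix y assume y: "y \<in> K"
          then have "y \<in> f ` ?S" using KS sur by blast
          then show "inv_into ?S f y \<in> U"
            using * y by (simp add: inv_into_into f_inv_into_f)
        qed
      qed
      also have "\<dots> \<longleftrightarrow> f ` (?S - U) \<subseteq> ?S - K" using sur by blast
      finally show ?thesis .
    qed
    then have "{f \<in> topspace ?T. (inv\<^bsub>homeo_group X\<^esub> f) ` K \<subseteq> U}
        = {f \<in> homeos X. f ` (?S - U) \<subseteq> ?S - K}"
      unfolding topspace_homeo_topology by (intro Collect_cong conj_cong refl)
    moreover have "compactin X (?S - U)"
      using X U by (simp add: closedin_compact_space closedin_diff)
    moreover have "openin X (?S - K)"
      using X K by (simp add: compactin_imp_closedin openin_diff)
    ultimately show "openin ?T {f \<in> topspace ?T. (inv\<^bsub>homeo_group X\<^esub> f) ` K \<subseteq> U}"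
      by (simp add: openin_homeo_topology)
  qed
  show ?thesis using G car mult inv
    by (simp add: topological_group_def topspace_homeo_topology)
qed

section \<open>The remainder of the natural numbers\<close>

definition beta_omega :: "((nat \<Rightarrow> real) \<Rightarrow> real) topology" where
  "beta_omega = cech_stone (discrete_topology UNIV)"

text \<open>The points of \<open>\<omega>\<close> are identified with their images in \<open>beta_omega\<close>.\<close>

definition omega_star :: "((nat \<Rightarrow> real) \<Rightarrow> real) topology" where
  "omega_star =
     subtopology beta_omega (topspace beta_omega - range (cech_stone_map (discrete_topology UNIV)))"

lemma compact_Hausdorff_omega_star: "compact_space omega_star" "Hausdorff_space omega_star"
proof -
  let ?D = "discrete_topology (UNIV :: nat set)" and ?e = "cech_stone_map (discrete_topology (UNIV :: nat set))"
  have "openin beta_omega {?e n}" for n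
  proof -
    define h where "h m = (if m = n then 1 else 0 :: real)" for m
    have h: "h \<in> unit_functions ?D"
      by (auto simp: unit_functions_def h_def)
    let ?W = "{p \<in> topspace beta_omega. p h \<in> {1/2<..}}"
    have "continuous_map beta_omega euclideanreal (\<lambda>p. p h)"
      using continuous_map_product_projection[OF h, of "\<lambda>f. top_of_set {0..1}"]
      unfolding beta_omega_def cech_stone_def unit_cube_def
      by (auto simp: continuous_map_in_subtopology intro: continuous_map_from_subtopology)
    then have W: "openin beta_omega ?W"
      by (rule openin_continuous_map_preimage) auto
    have "?e m \<in> ?W \<longleftrightarrow> m = n" for m
      using closure_of_subset[OF cech_stone_map_in[of ?D]] h
      by (auto simp: beta_omega_def topspace_cech_stone cech_stone_map_def h_def)
    moreover have "V \<inter> range e = {e n}" if "\<And>m. e m \<in> V \<longleftrightarrow> m = n"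
      for V and e :: "nat \<Rightarrow> (nat \<Rightarrow> real) \<Rightarrow> real"
      using that by auto
    ultimately have "?W \<inter> range ?e = {?e n}" by blast
    moreover have "?W \<subseteq> beta_omega closure_of (?W \<inter> range ?e)"
      using openin_Int_closure_of_subset[OF W, of "range ?e"] dense_cech_stone[of ?D]
      by (auto simp: beta_omega_def)
    moreover have "closedin beta_omega {?e n}"
      using Hausdorff_space_cech_stone[of ?D] closure_of_subset[OF cech_stone_map_in[of ?D]]
      by (intro closedin_Hausdorff_singleton)
        (use \<open>?W \<inter> range ?e = {?e n}\<close> in \<open>auto simp: beta_omega_def\<close>)
    ultimately have "?W = {?e n}"
      using closure_of_closedin[of beta_omega "{?e n}"] by force
    with W show ?thesis by simp
  qed
  then have "openin beta_omega (\<Union>n. {?e n})" by blast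
  then have "closedin beta_omega (topspace beta_omega - range ?e)"
    by (metis UNION_singleton_eq_range closedin_def closedin_diff closedin_topspace)
  then show "compact_space omega_star"
    using compact_space_cech_stone[of ?D]
    by (simp add: omega_star_def beta_omega_def closedin_compact_space compact_space_subtopology)
  show "Hausdorff_space omega_star"
    by (simp add: omega_star_def beta_omega_def Hausdorff_space_cech_stone Hausdorff_space_subtopology)
qed

lemma topological_group_homeo_omega_star:
  "topological_group (homeo_group omega_star) (homeo_topology omega_star)"
  by (intro topological_group_homeo_group compact_Hausdorff_omega_star)

end

theory Submission
  imports Defs
begin

text \<open>Permutations of \<open>\<omega>\<close> induce homeomorphisms of \<open>\<omega>\<^sup>*\<close>, and these already suffice. Partition
  \<open>\<omega>\<close> into infinitely many infinite sets \<open>B k\<close>; the homeomorphisms that preserve the traces of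
  all \<open>B k\<close> on \<open>\<omega>\<^sup>*\<close> contain a \<open>G\<^sub>\<delta>\<close>-set around the identity. A basic neighbourhood of the
  identity is given by finitely many pairs \<open>K \<subseteq> U\<close>. Picking points \<open>p k\<close> in the trace of
  \<open>B k\<close>, two of them, \<open>p k\<close> and \<open>p l\<close>, lie in exactly the same sets \<open>K\<close>. Exchanging a
  sufficiently small \<open>C \<subseteq> B k\<close> near \<open>p k\<close> with some \<open>D \<subseteq> B l\<close> near \<open>p l\<close> gives a homeomorphism
  in the neighbourhood which moves \<open>p k\<close> out of the trace of \<open>B k\<close>.\<close>

section \<open>Neighbourhoods of the identity in the compact-open topology\<close>

lemma generate_topology_on_finite_Inter:
  assumes "generate_topology_on \<S> G" "x \<in> G"
  obtains \<F> where "finite \<F>" "\<F> \<subseteq> \<S>" "x \<in> \<Inter>\<F>" "\<Inter>\<F> \<subseteq> G"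
proof -
  have "\<exists>\<F>. finite \<F> \<and> \<F> \<subseteq> \<S> \<and> x \<in> \<Inter>\<F> \<and> \<Inter>\<F> \<subseteq> G"
    using assms
  proof (induction rule: generate_topology_on.induct)
    case (Int a b)
    then obtain \<F> \<G> where "finite \<F>" "\<F> \<subseteq> \<S>" "x \<in> \<Inter>\<F>" "\<Inter>\<F> \<subseteq> a"
      and "finite \<G>" "\<G> \<subseteq> \<S>" "x \<in> \<Inter>\<G>" "\<Inter>\<G> \<subseteq> b" by blast
    then show ?case by (intro exI[of _ "\<F> \<union> \<G>"]) auto
  next
    case (UN \<K>)
    then obtain k where "k \<in> \<K>" "x \<in> k" by blast
    with UN.IH[OF this] show ?case by (meson Union_upper order_trans)
  next
    case (Basis s)
    then show ?case by (intro exI[of _ "{s}"]) auto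
  qed simp
  then show thesis using that by blast
qed

text \<open>Reduces an open set around the identity to finite data: it contains a finite
  intersection of subbasic sets around the identity, and the identity lies in the subbasic set of
  (\<open>K\<close>, \<open>U\<close>) only if \<open>K\<close> is a subset of
  \<open>U\<close>.\<close>

lemma homeo_topology_nbhd_id:
  assumes G: "openin (homeo_topology X) G" "restrict id (topspace X) \<in> G"
  obtains P where "finite P"
    "\<forall>(K, U) \<in> P. compactin X K \<and> openin X U \<and> K \<subseteq> U"
    "\<forall>f \<in> homeos X. (\<forall>(K, U) \<in> P. f ` K \<subseteq> U) \<longrightarrow> f \<in> G"
proof -
  \<comment> \<open>Writing the subbase as an image under \<open>N\<close> lets the finite subfamily
    be indexed by a finite set \<open>P\<close> of pairs.\<close>
  define N where "N \<equiv> \<lambda>(K, U). {f \<in> homeos X. f ` K \<subseteq> U}"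
  have "{{f \<in> homeos X. f ` K \<subseteq> U} |K U. compactin X K \<and> openin X U}
      = N ` {(K, U). compactin X K \<and> openin X U}"
    by (auto simp: N_def image_def)
  then have "generate_topology_on (N ` {(K, U). compactin X K \<and> openin X U}) G"
    using G(1) by (simp add: homeo_topology_def openin_topology_generated_by_iff)
  then obtain \<F> where \<F>: "finite \<F>" "\<F> \<subseteq> N ` {(K, U). compactin X K \<and> openin X U}"
    "restrict id (topspace X) \<in> \<Inter>\<F>" "\<Inter>\<F> \<subseteq> G"
    using G(2) by (rule generate_topology_on_finite_Inter)
  obtain P where P: "P \<subseteq> {(K, U). compactin X K \<and> openin X U}" "finite P" "\<F> = N ` P"
    using finite_subset_image[OF \<F>(1,2)] by blast
  show thesis
  proof
    have "compactin X K \<and> openin X U \<and> K \<subseteq> U" if KU: "(K, U) \<in> P" for K U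
    proof -
      have "compactin X K" "openin X U" using KU P by auto
      moreover have "restrict id (topspace X) ` K \<subseteq> U"
        using \<F>(3) KU unfolding P N_def by fastforce
      ultimately show ?thesis
        using compactin_subset_topspace[of X K] by (auto simp: image_subset_iff)
    qed
    then show "\<forall>(K, U) \<in> P. compactin X K \<and> openin X U \<and> K \<subseteq> U" by blast
  next
    have "f \<in> \<Inter>\<F>" if "f \<in> homeos X" "\<forall>(K, U) \<in> P. f ` K \<subseteq> U" for f
    proof -
      have "f \<in> N x" if "x \<in> P" for x
        using bspec[OF \<open>\<forall>(K, U) \<in> P. f ` K \<subseteq> U\<close> that] \<open>f \<in> homeos X\<close>
        by (simp add: N_def split_beta)
      then show ?thesis by (simp add: P)
    qed
    then show "\<forall>f \<in> homeos X. (\<forall>(K, U) \<in> P. f ` K \<subseteq> U) \<longrightarrow> f \<in> G"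
      by (intro ballI impI subsetD[OF \<F>(4)])
  qed (rule P)
qed

section \<open>An involution exchanging two disjoint sets of integers\<close>

lemma swap_involution:
  assumes "bij_betw h C D" "C \<inter> D = {}"
  obtains \<pi> where "\<And>n. \<pi> (\<pi> n) = n" "\<pi> ` C = D" "\<pi> ` D = C" "\<And>n. n \<notin> C \<union> D \<Longrightarrow> \<pi> n = n"
proof -
  define \<pi> where "\<pi> n = (if n \<in> C then h n else if n \<in> D then inv_into C h n else n)" for n
  have hC: "\<pi> n = h n" "h n \<in> D" "\<pi> (\<pi> n) = n" if "n \<in> C" for n
  proof -
    show "\<pi> n = h n" by (simp add: \<pi>_def that)
    show "h n \<in> D" by (rule bij_betwE[OF assms(1), rule_format, OF that])
    then have "h n \<notin> C" using assms(2) by blast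
    then show "\<pi> (\<pi> n) = n"
      by (simp add: \<pi>_def that \<open>h n \<in> D\<close> bij_betw_inv_into_left[OF assms(1)])
  qed
  have hD: "\<pi> n \<in> C" "\<pi> (\<pi> n) = n" if "n \<in> D" for n
  proof -
    have "\<pi> n = inv_into C h n" using that assms(2) by (auto simp: \<pi>_def)
    moreover have "inv_into C h n \<in> C"
      by (rule bij_betwE[OF bij_betw_inv_into[OF assms(1)], rule_format, OF that])
    ultimately show "\<pi> n \<in> C" "\<pi> (\<pi> n) = n"
      by (simp_all add: \<pi>_def bij_betw_inv_into_right[OF assms(1) that])
  qed
  have out: "\<pi> n = n" if "n \<notin> C \<union> D" for n using that by (simp add: \<pi>_def)
  moreover have "\<pi> (\<pi> n) = n" for n
    using hC(3) hD(2) out by (metis UnE)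
  moreover have "\<pi> ` C = D"
    using hC(1) assms(1) by (simp add: bij_betw_def cong: image_cong)
  moreover have "\<pi> ` D = C"
  proof
    show "\<pi> ` D \<subseteq> C" using hD(1) by blast
    show "C \<subseteq> \<pi> ` D"
    proof
      fix n assume "n \<in> C"
      then show "n \<in> \<pi> ` D" using hC[of n] by (metis image_eqI)
    qed
  qed
  ultimately show thesis using that by blast
qed

section \<open>Points of the compactification and their values at indicators\<close>

abbreviation omega_map :: "nat \<Rightarrow> (nat \<Rightarrow> real) \<Rightarrow> real" where
  "omega_map \<equiv> cech_stone_map (discrete_topology UNIV)"

lemma beta_omega_closure_omega: "beta_omega closure_of (range omega_map) = topspace beta_omega"
  using dense_cech_stone[of "discrete_topology (UNIV :: nat set)"] by (simp add: beta_omega_def)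

lemma omega_map_in: "omega_map n \<in> topspace beta_omega"
  using closure_of_subset[OF cech_stone_map_in[of "discrete_topology (UNIV :: nat set)"]]
  by (auto simp: beta_omega_def topspace_cech_stone)

lemma compact_beta_omega: "compact_space beta_omega"
  and Hausdorff_beta_omega: "Hausdorff_space beta_omega"
  by (simp_all add: beta_omega_def compact_space_cech_stone Hausdorff_space_cech_stone)

lemma topspace_omega_star: "topspace omega_star = topspace beta_omega - range omega_map"
  by (auto simp: omega_star_def)

text \<open>Points of \<open>beta_omega\<close> are functions on \<open>unit_functions\<close>, so
  they can be evaluated at an indicator. The value \<open>p (indicator B)\<close> is that of the
  continuous extension of the characteristic function of \<open>B\<close>; with \<open>p\<close>
  seen as an ultrafilter, it is 1 exactly when \<open>B\<close> belongs to \<open>p\<close>.\<close>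

lemma indicator_unit_function:
  "(indicator B :: nat \<Rightarrow> real) \<in> unit_functions (discrete_topology UNIV)"
  by (auto simp: unit_functions_def indicator_def)

lemma omega_map_indicator: "omega_map n (indicator B) = indicator B n"
  by (simp add: cech_stone_map_def indicator_unit_function)

lemma continuous_beta_omega_eval:
  "continuous_map beta_omega euclideanreal (\<lambda>p. p (indicator B))"
  using continuous_map_product_projection[OF indicator_unit_function, of "\<lambda>f. top_of_set {0..1}"]
  unfolding beta_omega_def cech_stone_def unit_cube_def
  by (auto simp: continuous_map_in_subtopology intro: continuous_map_from_subtopology)

lemma inj_omega_map: "inj omega_map"
  by (rule injI) (metis indicator_simps omega_map_indicator singleton_iff zero_neq_one)

lemma eval_eq_on_closure:
  assumes "p \<in> beta_omega closure_of (omega_map ` A)" "\<And>n. n \<in> A \<Longrightarrow> indicator B n = (c :: real)"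
  shows "p (indicator B) = c"
  by (rule forall_in_closure_of_eq[OF assms(1) _ continuous_beta_omega_eval, of "\<lambda>_. c"])
    (auto simp: omega_map_indicator assms(2))

text \<open>By compactness an infinite subset of \<omega> accumulates somewhere, and not at a point
  of \<omega>, since these are isolated from the rest of \<omega>.\<close>

lemma omega_star_trace_nonempty:
  assumes "infinite B"
  obtains p where "p \<in> topspace omega_star" "p (indicator B) = 1"
proof -
  have "infinite (omega_map ` B)"
    using assms inj_omega_map by (metis finite_imageD inj_on_subset top_greatest)
  then obtain p where p: "p \<in> beta_omega derived_set_of (omega_map ` B)"
    using compact_space_imp_Bolzano_Weierstrass[OF compact_beta_omega] omega_map_in by blast
  then have "p \<in> beta_omega closure_of (omega_map ` B)"
    by (rule subsetD[OF derived_set_of_subset_closure_of])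
  then have 1: "p (indicator B) = 1" by (rule eval_eq_on_closure) simp
  have "p \<noteq> omega_map n" for n
  proof
    assume pn: "p = omega_map n"
    let ?W = "{q \<in> topspace beta_omega. q (indicator {n}) \<in> {1/2<..}}"
    have "openin beta_omega ?W"
      by (rule openin_continuous_map_preimage[OF continuous_beta_omega_eval]) auto
    moreover have "p \<in> ?W" by (simp add: pn omega_map_in omega_map_indicator)
    ultimately have "\<exists>q. q \<noteq> p \<and> q \<in> omega_map ` B \<and> q \<in> ?W"
      using p unfolding in_derived_set_of by (metis (no_types, lifting))
    then obtain q where q: "q \<noteq> p" "q \<in> omega_map ` B" "q \<in> ?W" by (elim exE conjE)
    from q(2) obtain m where m: "q = omega_map m" by (rule imageE)
    have "indicator {n} m > (1/2 :: real)" using q(3) by (simp add: m omega_map_indicator)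
    then have "m = n" by (cases "m = n") simp_all
    then show False using q(1) by (simp add: m pn)
  qed
  moreover have "p \<in> topspace beta_omega"
    using p by (simp add: in_derived_set_of)
  ultimately show thesis using that 1 by (auto simp: topspace_omega_star)
qed

text \<open>Regularity gives a closed neighbourhood of \<open>p\<close> inside \<open>W\<close>;
  take for \<open>C\<close> the integers in an open \<open>V\<close> below it. Density of \<omega>
  puts \<open>p\<close> into the closure of \<open>C\<close>. A finite \<open>C\<close> would be
  closed, which would make \<open>p\<close> a point of \<omega>.\<close>

lemma small_trace:
  assumes p: "p \<in> topspace omega_star" and W: "openin beta_omega W" "p \<in> W"
  obtains C where "infinite C" "p \<in> beta_omega closure_of (omega_map ` C)"
    "beta_omega closure_of (omega_map ` C) \<subseteq> W"
proof -
  have "neighbourhood_base_of (closedin beta_omega) beta_omega"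
    unfolding neighbourhood_base_of_closedin
    by (simp add: compact_Hausdorff_imp_regular_space compact_beta_omega Hausdorff_beta_omega)
  then obtain V F where V: "openin beta_omega V" "p \<in> V" "V \<subseteq> F"
    and F: "closedin beta_omega F" "F \<subseteq> W"
    using W unfolding neighbourhood_base_of by (metis (no_types, lifting))
  define C where "C = {n. omega_map n \<in> V}"
  have C: "omega_map ` C = V \<inter> range omega_map" unfolding C_def by blast
  have pC: "p \<in> beta_omega closure_of (omega_map ` C)"
    using openin_Int_closure_of_subset[OF V(1), of "range omega_map"] V(2) p
    by (auto simp: C beta_omega_closure_omega topspace_omega_star)
  moreover have "beta_omega closure_of (omega_map ` C) \<subseteq> W"
    using closure_of_minimal[OF _ F(1), of "omega_map ` C"] V F by (auto simp: C)
  moreover have "infinite C"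
  proof
    assume "finite C"
    then have "closedin beta_omega (omega_map ` C)"
      by (intro closedin_Hausdorff_finite[OF Hausdorff_beta_omega]) (auto simp: omega_map_in)
    then have "p \<in> omega_map ` C" using pC closure_of_closedin by blast
    then show False using p by (auto simp: topspace_omega_star)
  qed
  ultimately show thesis using that by blast
qed

section \<open>Homeomorphisms of the remainder induced by permutations\<close>

lemma omega_star_involution:
  assumes \<pi>: "\<And>n. \<pi> (\<pi> n) = n"
  obtains g where "restrict g (topspace omega_star) \<in> homeos omega_star"
    "continuous_map beta_omega beta_omega g" "\<And>n. g (omega_map n) = omega_map (\<pi> n)"
proof -
  have "continuous_map (discrete_topology UNIV) beta_omega (\<lambda>n. omega_map (\<pi> n))"
    by (simp add: omega_map_in)
  then obtain g where cont: "continuous_map beta_omega beta_omega g"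
    and g: "\<And>n. g (omega_map n) = omega_map (\<pi> n)"
    using cech_stone_extension[of "discrete_topology (UNIV :: nat set)" beta_omega]
      compact_beta_omega Hausdorff_beta_omega
    unfolding beta_omega_def by (metis UNIV_I topspace_discrete_topology)
  \<comment> \<open>The square of \<open>g\<close> agrees with the identity on the dense set
    \<omega>. So \<open>g\<close> is its own inverse, and as it maps \<omega> into \<omega>, it also
    maps the remainder into itself.\<close>
  have gg: "g (g p) = p" if "p \<in> topspace beta_omega" for p
  proof -
    have "continuous_map beta_omega beta_omega (\<lambda>p. g (g p))"
      using continuous_map_compose[OF cont cont] by (simp add: o_def)
    then show ?thesis
      using that forall_in_closure_of_eq[of p beta_omega "range omega_map" beta_omega "\<lambda>p. g (g p)" "\<lambda>p. p"]
      by (force simp: beta_omega_closure_omega Hausdorff_beta_omega g \<pi>)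
  qed
  have "g p \<in> topspace omega_star" if "p \<in> topspace omega_star" for p
  proof -
    have "g p \<notin> range omega_map"
    proof
      assume "g p \<in> range omega_map"
      then have "g (g p) \<in> range omega_map" by (auto simp: g)
      then show False using gg that by (auto simp: topspace_omega_star)
    qed
    then show ?thesis
      using that cont by (auto simp: topspace_omega_star continuous_map_def)
  qed
  then have "continuous_map omega_star omega_star g"
    using cont
    by (auto simp: omega_star_def continuous_map_in_subtopology topspace_omega_star
        intro: continuous_map_from_subtopology)
  then have "homeomorphic_maps omega_star omega_star g g"
    by (auto simp: homeomorphic_maps_def gg topspace_omega_star)
  then have "homeomorphic_map omega_star omega_star g"
    by (rule homeomorphic_maps_imp_map)
  then have "homeomorphic_map omega_star omega_star (restrict g (topspace omega_star))"
    by (rule homeomorphic_map_eq) simp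
  then show thesis using that cont g by (simp add: homeos_def)
qed

text \<open>Closure commutes with finite unions, so a point outside the closures of \<open>C\<close>
  and \<open>D\<close> lies in the closure of the remaining integers. These are fixed, hence so is
  the point.\<close>

lemma omega_star_swap:
  assumes CD: "infinite C" "infinite D" "C \<inter> D = {}"
  obtains g where "g \<in> homeos omega_star"
    "\<And>p. p \<in> topspace omega_star \<Longrightarrow> p \<in> beta_omega closure_of (omega_map ` C)
      \<Longrightarrow> g p \<in> beta_omega closure_of (omega_map ` D)"
    "\<And>p. p \<in> topspace omega_star \<Longrightarrow> p \<in> beta_omega closure_of (omega_map ` D)
      \<Longrightarrow> g p \<in> beta_omega closure_of (omega_map ` C)"
    "\<And>p. p \<in> topspace omega_star \<Longrightarrow> p \<notin> beta_omega closure_of (omega_map ` C)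
      \<Longrightarrow> p \<notin> beta_omega closure_of (omega_map ` D) \<Longrightarrow> g p = p"
proof -
  have "bij_betw (enumerate D \<circ> inv_into UNIV (enumerate C)) C D"
    using CD bij_betw_trans bij_betw_inv_into bij_enumerate by blast
  then obtain \<pi> where \<pi>: "\<And>n. \<pi> (\<pi> n) = n" "\<pi> ` C = D" "\<pi> ` D = C" "\<And>n. n \<notin> C \<union> D \<Longrightarrow> \<pi> n = n"
    using swap_involution[OF _ CD(3)] by metis
  obtain g where g: "restrict g (topspace omega_star) \<in> homeos omega_star"
    "continuous_map beta_omega beta_omega g" "\<And>n. g (omega_map n) = omega_map (\<pi> n)"
    using omega_star_involution[OF \<pi>(1)] by blast
  have img: "g p \<in> beta_omega closure_of (omega_map ` \<pi> ` A)"
    if "p \<in> beta_omega closure_of (omega_map ` A)" for p A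
    using continuous_map_image_closure_subset[OF g(2), of "omega_map ` A"] that
    by (auto simp: image_image g(3))
  have fixed: "g p = p" if "p \<in> topspace omega_star"
    "p \<notin> beta_omega closure_of (omega_map ` C)" "p \<notin> beta_omega closure_of (omega_map ` D)" for p
  proof -
    have "range omega_map = omega_map ` C \<union> omega_map ` D \<union> omega_map ` (- (C \<union> D))" by auto
    then have "p \<in> beta_omega closure_of (omega_map ` (- (C \<union> D)))"
      using that beta_omega_closure_omega by (auto simp: topspace_omega_star closure_of_Un)
    then show ?thesis
      by (rule forall_in_closure_of_eq[OF _ Hausdorff_beta_omega g(2) continuous_map_id[unfolded id_def]])
        (auto simp: g(3) \<pi>(4))
  qed
  show thesis
    using img[of _ C] img[of _ D] fixed by (intro that[OF g(1)]) (auto simp: \<pi>)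
qed

section \<open>The open set that would have to exist, and a swap that leaves it\<close>

theorem corollary5p3:
  shows "\<not> P_group (homeo_group omega_star) (homeo_topology omega_star)"
proof
  assume "P_group (homeo_group omega_star) (homeo_topology omega_star)"
  then have PS: "P_space (homeo_topology omega_star)" by (simp add: P_group_def)
  define B :: "nat \<Rightarrow> nat set" where "B k = range (\<lambda>m. prod_encode (k, m))" for k
  have infB: "infinite (B k)" for k
    unfolding B_def by (rule range_inj_infinite) (simp add: inj_def)
  have disjB: "B k \<inter> B l = {}" if "k \<noteq> l" for k l
    using that by (auto simp: B_def)
  \<comment> \<open>\<open>K k\<close> and \<open>U k\<close> both describe the trace of
    \<open>B k\<close>, because by density the value at an indicator is 0 or 1. The first form is
    visibly closed, the second visibly open.\<close>
  define K where "K k = {p \<in> topspace omega_star. p (indicator (B k)) = 1}" for k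
  define U where "U k = {p \<in> topspace omega_star. p (indicator (B k)) > 1/2}" for k
  have ev: "continuous_map omega_star euclideanreal (\<lambda>p. p (indicator A))" for A
    unfolding omega_star_def by (intro continuous_map_from_subtopology continuous_beta_omega_eval)
  have "closedin omega_star (K k)" for k
    unfolding K_def using closedin_continuous_map_preimage[OF ev, of "{1}"] by simp
  then have K: "compactin omega_star (K k)" for k
    by (rule closedin_compact_space[OF compact_Hausdorff_omega_star(1)])
  have U: "openin omega_star (U k)" for k
    unfolding U_def using openin_continuous_map_preimage[OF ev, of "{1/2<..}"] by simp
  define G where "G = (\<Inter>k. {f \<in> homeos omega_star. f ` K k \<subseteq> U k})"
  have "gdelta_in (homeo_topology omega_star) G"
    unfolding G_def using K U
    by (intro gdelta_in_Inter) (auto intro!: open_imp_gdelta_in openin_homeo_topology)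
  then have Gopen: "openin (homeo_topology omega_star) G" using PS by (simp add: P_space_def)
  have "homeomorphic_map omega_star omega_star (restrict id (topspace omega_star))"
    by (rule homeomorphic_map_eq[of _ _ id]) auto
  then have idG: "restrict id (topspace omega_star) \<in> G"
    by (auto simp: G_def homeos_def K_def U_def)
  obtain P where P: "finite P"
    and PKU': "\<forall>(K, U) \<in> P. compactin omega_star K \<and> openin omega_star U \<and> K \<subseteq> U"
    and PG: "\<forall>f \<in> homeos omega_star. (\<forall>(K, U) \<in> P. f ` K \<subseteq> U) \<longrightarrow> f \<in> G"
    by (rule homeo_topology_nbhd_id[OF Gopen idG])
  have PKU: "compactin omega_star K \<and> openin omega_star U \<and> K \<subseteq> U" if "(K, U) \<in> P" for K U
    using PKU' that by blast
  have "\<exists>p. p \<in> topspace omega_star \<and> p (indicator (B k)) = 1" for k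
    using omega_star_trace_nonempty[OF infB] by metis
  then obtain p where p: "\<And>k. p k \<in> topspace omega_star" "\<And>k. p k (indicator (B k)) = 1"
    by metis
  \<comment> \<open>Pigeonhole: \<open>S\<close> takes values in the finite power set of
    \<open>P\<close>, so two of the infinitely many points have the same \<open>S\<close>.\<close>
  define S where "S k = {(K, U) \<in> P. p k \<in> K}" for k
  have "finite (range S)"
    by (rule finite_subset[of _ "Pow P"]) (use P in \<open>auto simp: S_def\<close>)
  then have "\<not> inj S" using finite_imageD by blast
  then obtain k l where kl: "k \<noteq> l" "S k = S l" by (auto simp: inj_def)
  \<comment> \<open>For a pair (\<open>K\<close>, \<open>U\<close>) the swap has to stay inside
    \<open>U\<close> if \<open>p k\<close> lies in \<open>K\<close>; otherwise it has to avoid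
    \<open>K\<close>, so that all points of \<open>K\<close> are fixed. Either condition is the
    trace of an open set of \<open>beta_omega\<close>.\<close>
  have KUopen: "\<exists>V. openin beta_omega V \<and> V \<inter> topspace omega_star =
      (if p k \<in> fst x then snd x else topspace omega_star - fst x)" if "x \<in> P" for x
  proof -
    have "closedin omega_star (fst x)" "openin omega_star (snd x)"
      using PKU[of "fst x" "snd x"] that
      by (auto intro: compactin_imp_closedin compact_Hausdorff_omega_star)
    then have "openin omega_star (if p k \<in> fst x then snd x else topspace omega_star - fst x)"
      by auto
    then show ?thesis
      by (auto simp: omega_star_def openin_subtopology topspace_omega_star[unfolded omega_star_def])
  qed
  then obtain V where V: "\<And>x. x \<in> P \<Longrightarrow> openin beta_omega (V x)"
    "\<And>x. x \<in> P \<Longrightarrow> V x \<inter> topspace omega_star =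
      (if p k \<in> fst x then snd x else topspace omega_star - fst x)"
    by metis
  \<comment> \<open>The first factor forces every set of integers with closure inside
    \<open>W j\<close> into \<open>B j\<close>. The second handles all pairs of \<open>P\<close> at
    once; the whole space in it covers an empty \<open>P\<close>.\<close>
  define W where "W j = {q \<in> topspace beta_omega. q (indicator (B j)) \<in> {1/2<..}}
      \<inter> (topspace beta_omega \<inter> \<Inter>(V ` P))" for j
  have W: "openin beta_omega (W j)" for j
    unfolding W_def using P V
    by (intro openin_Int openin_continuous_map_preimage[OF continuous_beta_omega_eval]
         openin_Int_Inter) auto
  have pW: "p j \<in> W j" if "j \<in> {k, l}" for j
  proof -
    \<comment> \<open>\<open>V\<close> was chosen for \<open>p k\<close>; it also suits
      \<open>p l\<close>, because both points lie in the same first components.\<close>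
    have "p j \<in> V x" if x: "x \<in> P" for x
    proof -
      have "S j = S k" using \<open>j \<in> {k, l}\<close> kl by auto
      then have "x \<in> S j \<longleftrightarrow> x \<in> S k" by simp
      then have "p j \<in> fst x \<longleftrightarrow> p k \<in> fst x"
        using x by (simp add: S_def split_beta)
      then show ?thesis
        using V(2)[OF x] PKU[of "fst x" "snd x"] x p(1)[of j] by (auto split: if_splits)
    qed
    then show ?thesis using p[of j] by (auto simp: W_def topspace_omega_star)
  qed
  obtain C where C: "infinite C" "p k \<in> beta_omega closure_of (omega_map ` C)"
    "beta_omega closure_of (omega_map ` C) \<subseteq> W k"
    using small_trace[OF p(1) W pW] by blast
  obtain D where D: "infinite D" "beta_omega closure_of (omega_map ` D) \<subseteq> W l"
    using small_trace[OF p(1) W pW] by blast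
  have sub: "A \<subseteq> B j" if "beta_omega closure_of (omega_map ` A) \<subseteq> W j" for A j
  proof
    fix n assume "n \<in> A"
    then have "omega_map n \<in> W j"
      using that closure_of_subset[of "omega_map ` A" beta_omega] omega_map_in by blast
    then show "n \<in> B j"
      by (cases "n \<in> B j") (auto simp: W_def omega_map_indicator)
  qed
  have "C \<subseteq> B k" "D \<subseteq> B l" using sub C D by auto
  then have CD: "C \<inter> D = {}" and Dk: "D \<inter> B k = {}" using disjB[OF kl(1)] by auto
  obtain g where g: "g \<in> homeos omega_star"
    and gC: "\<And>p. p \<in> topspace omega_star \<Longrightarrow> p \<in> beta_omega closure_of (omega_map ` C)
      \<Longrightarrow> g p \<in> beta_omega closure_of (omega_map ` D)"
    and gD: "\<And>p. p \<in> topspace omega_star \<Longrightarrow> p \<in> beta_omega closure_of (omega_map ` D)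
      \<Longrightarrow> g p \<in> beta_omega closure_of (omega_map ` C)"
    and gn: "\<And>p. p \<in> topspace omega_star \<Longrightarrow> p \<notin> beta_omega closure_of (omega_map ` C)
      \<Longrightarrow> p \<notin> beta_omega closure_of (omega_map ` D) \<Longrightarrow> g p = p"
    using omega_star_swap[OF C(1) D(1) CD] by blast
  have gt: "g q \<in> topspace omega_star" if "q \<in> topspace omega_star" for q
    using g that homeomorphic_imp_surjective_map[of omega_star omega_star g]
    by (auto simp: homeos_def)
  have "g ` K \<subseteq> U" if KU: "(K, U) \<in> P" for K U
  proof (rule image_subsetI)
    fix q assume q: "q \<in> K"
    have qt: "q \<in> topspace omega_star"
      using q PKU[OF KU] compactin_subset_topspace by blast
    show "g q \<in> U"
    proof (cases "q \<in> beta_omega closure_of (omega_map ` C) \<union> beta_omega closure_of (omega_map ` D)")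
      case True
      \<comment> \<open>\<open>V (K, U)\<close> contains the closures of \<open>C\<close> and
        \<open>D\<close>, each of which \<open>g\<close> sends into the other on the remainder.
        Since \<open>q\<close> is in \<open>K\<close>, the alternative avoiding \<open>K\<close> is
        excluded, so the trace of \<open>V (K, U)\<close> is \<open>U\<close>.\<close>
      then have "q \<in> V (K, U)" "g q \<in> V (K, U)"
        using C(3) D(2) gC[OF qt] gD[OF qt] KU by (auto simp: W_def)
      then show ?thesis
        using V(2)[OF KU] q qt gt[OF qt] by (auto split: if_splits)
    next
      case False
      then have "g q = q" using gn qt by blast
      then show ?thesis using q PKU[OF KU] by auto
    qed
  qed
  then have "g \<in> G" using PG g by blast
  then have "g ` K k \<subseteq> U k" by (simp add: G_def)
  moreover have "p k \<in> K k" using p by (simp add: K_def)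
  ultimately have "g (p k) \<in> U k" by blast
  \<comment> \<open>\<open>g (p k)\<close> lies in the closure of \<open>D\<close>, and
    \<open>D\<close> misses \<open>B k\<close>.\<close>
  moreover have "g (p k) (indicator (B k)) = 0"
    by (rule eval_eq_on_closure[OF gC[OF p(1) C(2)]]) (use Dk in \<open>auto simp: indicator_def\<close>)
  ultimately show False by (simp add: U_def)
qed

end
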